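(* Let $R$ be a complete discrete valuation ring of equal characteristic with maximal ideal $\mathfrak{p}$ and finite residue field $k=R/\mathfrak{p}$ with $|k|>9$, and let $n\ge2$. Let $H$ be a closed subgroup of $\mathrm{SL}_n(R)$ such that $H^{[0]}=\mathrm{SL}_n(k)$ and $H^{[1]}$ contains a non-scalar matrix. Then $H=\mathrm{SL}_n(R)$.
   Context: For a subgroup $H\subset\mathrm{GL}_n(R)$ and $i\ge0$ let $H^i=\{h\in H: h\equiv\mathrm{Id}_n \bmod \mathfrak{p}^i\}$ and $H^{[i]}=H^i/H^{i+1}$. $H^{[0]}$ is identified with the image of $H$ in $\mathrm{GL}_n(k)$, and for $i>0$, $H^{[i]}$ is identified with a subgroup of $\mathfrak{gl}_n(\mathfrak{p}^i/\mathfrak{p}^{i+1})$ via $[\mathrm{Id}_n+X]\mapsto[X]$. Topology is the one induced by $R$. *)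

theory Defs
  imports "HOL-Analysis.Analysis"
begin

definition dvr_uniformizer :: "'a::idom \<Rightarrow> bool" where
  "dvr_uniformizer \<pi> \<longleftrightarrow> \<pi> \<noteq> 0 \<and> \<not> \<pi> dvd 1 \<and>
     (\<forall>x. x \<noteq> 0 \<longrightarrow> (\<exists>u m. u dvd 1 \<and> x = u * \<pi> ^ m))"

definition padic_complete :: "'a::idom \<Rightarrow> bool" where
  "padic_complete \<pi> \<longleftrightarrow>
     (\<forall>x::nat \<Rightarrow> 'a. (\<forall>m. \<exists>N. \<forall>a\<ge>N. \<forall>b\<ge>N. \<pi> ^ m dvd (x a - x b)) \<longrightarrow>
        (\<exists>L. \<forall>m. \<exists>N. \<forall>a\<ge>N. \<pi> ^ m dvd (x a - L)))"

definition residue_classes :: "'a::idom \<Rightarrow> 'a set set" where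
  "residue_classes \<pi> = (\<lambda>x. {y. \<pi> dvd (x - y)}) ` UNIV"

definition equal_char :: "'a::idom \<Rightarrow> bool" where
  "equal_char \<pi> \<longleftrightarrow> (\<forall>m::nat. (of_nat m = (0::'a)) \<longleftrightarrow> \<pi> dvd of_nat m)"

definition mat_cong :: "'a::idom \<Rightarrow> nat \<Rightarrow> 'a^'n^'n \<Rightarrow> 'a^'n^'n \<Rightarrow> bool" where
  "mat_cong \<pi> i A B \<longleftrightarrow> (\<forall>r s. \<pi> ^ i dvd (A $ r $ s - B $ r $ s))"

definition SL :: "(('a::idom)^'n^'n) set" where
  "SL = {A. det A = 1}"

definition is_subgroup_SL :: "(('a::idom)^'n^'n) set \<Rightarrow> bool" where
  "is_subgroup_SL H \<longleftrightarrow> H \<subseteq> SL \<and> mat 1 \<in> H \<and>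
     (\<forall>g\<in>H. \<forall>h\<in>H. g ** h \<in> H) \<and> (\<forall>h\<in>H. \<exists>g\<in>H. h ** g = mat 1)"

definition padic_closed :: "'a::idom \<Rightarrow> ('a^'n^'n) set \<Rightarrow> bool" where
  "padic_closed \<pi> H \<longleftrightarrow> (\<forall>A. (\<forall>i. \<exists>h\<in>H. mat_cong \<pi> i h A) \<longrightarrow> A \<in> H)"

text \<open>H^[0] = SL_n(k): every matrix over R whose reduction lies in SL_n(k)
 (i.e. det \<equiv> 1 mod \<pi>) has the same reduction as some element of H.
 (Every matrix over k lifts to R and reduction commutes with det.)\<close>
definition reduction_is_SL :: "'a::idom \<Rightarrow> ('a^'n^'n) set \<Rightarrow> bool" where
  "reduction_is_SL \<pi> H \<longleftrightarrow>
     (\<forall>B. \<pi> dvd (det B - 1) \<longrightarrow> (\<exists>h\<in>H. mat_cong \<pi> 1 h B)) \<and>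
     (\<forall>h\<in>H. \<pi> dvd (det h - 1))"

text \<open>H^[1] contains a non-scalar matrix: some h = Id + X in H with X \<equiv> 0 mod \<pi>
 such that [X] in gl_n(p/p^2) is not scalar, i.e. X is not congruent mod \<pi>^2 to c*Id.\<close>
definition level1_nonscalar :: "'a::idom \<Rightarrow> ('a^'n^'n) set \<Rightarrow> bool" where
  "level1_nonscalar \<pi> H \<longleftrightarrow>
     (\<exists>h\<in>H. mat_cong \<pi> 1 h (mat 1) \<and> \<not> (\<exists>c. mat_cong \<pi> 2 (h - mat 1) (mat c)))"

end

theory Submission
  imports Defs
begin

text \<open>
  Every layer H^[i] with i > 0 is an additive group of matrices stable under conjugation by SL_n(k).
  A non-scalar element of such a group can be moved, by differences of conjugates under
  transvections and diagonal matrices, to a single off-diagonal entry, and then generates all of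
  sl_n(k). Since the layers of SL_n(R) have trace zero, surjectivity of H modulo \<pi>^i together with
  one non-scalar element in H^[i] gives surjectivity modulo \<pi>^(i+1), and H is closed.

  For i > 1 a non-scalar element of H^[i] is the leading term of a commutator of lifts of the
  transvections 1 + \<pi> E_sr and 1 + \<pi>^(i-1) E_rs, namely E_ss - E_rr. This is scalar exactly for
  n = 2 and residue characteristic 2. There one uses diag(1+\<pi>, 1/(1+\<pi>)) and
  1 + x \<pi>^(i-2) E_rs instead: the first acts on E_rs as (1+\<pi>)^2 = 1 + \<pi>^2, by equal characteristic.
\<close>

section \<open>Matrices over commutative rings\<close>

lemma mat_congI: "(\<And>r s. \<pi> ^ i dvd (A $ r $ s - B $ r $ s)) \<Longrightarrow> mat_cong \<pi> i A B"
  by (simp add: mat_cong_def)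

lemma mat_congD: "mat_cong \<pi> i A B \<Longrightarrow> \<pi> ^ i dvd (A $ r $ s - B $ r $ s)"
  by (simp add: mat_cong_def)

lemma mat_cong_refl [simp]: "mat_cong \<pi> i A A"
  by (simp add: mat_cong_def)

lemma mat_cong_sym: "mat_cong \<pi> i A B \<Longrightarrow> mat_cong \<pi> i B A"
  unfolding mat_cong_def by (metis dvd_minus_iff minus_diff_eq)

lemma mat_cong_trans [trans]:
  assumes "mat_cong \<pi> i A B" "mat_cong \<pi> i B C"
  shows "mat_cong \<pi> i A C"
proof (rule mat_congI)
  fix r s
  have "\<pi> ^ i dvd (A $ r $ s - B $ r $ s) + (B $ r $ s - C $ r $ s)"
    using assms by (intro dvd_add mat_congD)
  then show "\<pi> ^ i dvd A $ r $ s - C $ r $ s" by simp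
qed

lemma mat_cong_mono: "mat_cong \<pi> i A B \<Longrightarrow> j \<le> i \<Longrightarrow> mat_cong \<pi> j A B"
  unfolding mat_cong_def by (meson dvd_trans le_imp_power_dvd)

lemma mat_cong_add:
  assumes "mat_cong \<pi> i A B" "mat_cong \<pi> i C D"
  shows "mat_cong \<pi> i (A + C) (B + D)"
proof (rule mat_congI)
  fix r s
  have "\<pi> ^ i dvd (A $ r $ s - B $ r $ s) + (C $ r $ s - D $ r $ s)"
    using assms by (intro dvd_add mat_congD)
  then show "\<pi> ^ i dvd (A + C) $ r $ s - (B + D) $ r $ s" by (simp add: algebra_simps)
qed

lemma mat_cong_diff:
  assumes "mat_cong \<pi> i A B" "mat_cong \<pi> i C D"
  shows "mat_cong \<pi> i (A - C) (B - D)"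
proof (rule mat_congI)
  fix r s
  have "\<pi> ^ i dvd (A $ r $ s - B $ r $ s) - (C $ r $ s - D $ r $ s)"
    using assms by (intro dvd_diff mat_congD)
  then show "\<pi> ^ i dvd (A - C) $ r $ s - (B - D) $ r $ s" by (simp add: algebra_simps)
qed

lemma mat_cong_mult_left:
  assumes "mat_cong \<pi> i C D"
  shows "mat_cong \<pi> i (A ** C) (A ** D)"
proof (rule mat_congI)
  fix r s
  have "\<pi> ^ i dvd (\<Sum>k\<in>UNIV. A $ r $ k * (C $ k $ s - D $ k $ s))"
    using assms by (intro dvd_sum dvd_mult mat_congD)
  then show "\<pi> ^ i dvd (A ** C) $ r $ s - (A ** D) $ r $ s"
    by (simp add: matrix_matrix_mult_def algebra_simps sum_subtractf)
qed

lemma mat_cong_mult_right: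
  assumes "mat_cong \<pi> i A B"
  shows "mat_cong \<pi> i (A ** C) (B ** C)"
proof (rule mat_congI)
  fix r s
  have "\<pi> ^ i dvd (\<Sum>k\<in>UNIV. (A $ r $ k - B $ r $ k) * C $ k $ s)"
    using assms by (intro dvd_sum dvd_mult2 mat_congD)
  then show "\<pi> ^ i dvd (A ** C) $ r $ s - (B ** C) $ r $ s"
    by (simp add: matrix_matrix_mult_def algebra_simps sum_subtractf)
qed

lemma mat_cong_mult:
  "mat_cong \<pi> i A B \<Longrightarrow> mat_cong \<pi> i C D \<Longrightarrow> mat_cong \<pi> i (A ** C) (B ** D)"
  by (meson mat_cong_mult_left mat_cong_mult_right mat_cong_trans)

definition mat_scale :: "'a::semiring_1 \<Rightarrow> 'a^'n^'m \<Rightarrow> 'a^'n^'m" where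
  "mat_scale c A = (\<chi> i j. c * A $ i $ j)"

lemma mat_scale_nth [simp]: "mat_scale c A $ i $ j = c * A $ i $ j"
  by (simp add: mat_scale_def)

lemma mat_scale_mult_left: "mat_scale c A ** B = mat_scale c (A ** B)"
  by (simp add: vec_eq_iff matrix_matrix_mult_def sum_distrib_left mult.assoc)

lemma mat_scale_mult_right:
  fixes c :: "'a::comm_semiring_1"
  shows "A ** mat_scale c B = mat_scale c (A ** B)"
  by (simp add: vec_eq_iff matrix_matrix_mult_def sum_distrib_left mult.left_commute)

lemma matrix_add_rdistrib: "(A + B) ** C = A ** C + B ** (C :: 'a::semiring_1^'p^'n)"
  by (simp add: vec_eq_iff matrix_matrix_mult_def distrib_right sum.distrib)

lemma mat_scale_add: "mat_scale c (A + B) = mat_scale c A + mat_scale c B"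
  by (simp add: vec_eq_iff distrib_left)

lemma mat_cong_scale:
  "mat_cong \<pi> j A B \<Longrightarrow> mat_cong \<pi> (i + j) (mat_scale (\<pi> ^ i) A) (mat_scale (\<pi> ^ i) B)"
  by (simp add: mat_cong_def power_add mult_dvd_mono flip: right_diff_distrib)

lemma mat_cong_scale_zero: "j \<le> i \<Longrightarrow> mat_cong \<pi> j (mat_scale (\<pi> ^ i) A) 0"
  by (simp add: mat_cong_def le_imp_power_dvd)

lemma mat_cong_obtain:
  assumes "mat_cong \<pi> i A B"
  obtains Y where "A = B + mat_scale (\<pi> ^ i) Y"
proof -
  have "\<forall>r s. \<exists>y. A $ r $ s - B $ r $ s = \<pi> ^ i * y"
    using assms by (auto simp: mat_cong_def dvd_def)
  then obtain y where "\<And>r s. A $ r $ s - B $ r $ s = \<pi> ^ i * y r s" by metis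
  then have "A = B + mat_scale (\<pi> ^ i) (\<chi> r s. y r s)"
    by (simp add: vec_eq_iff algebra_simps)
  then show ?thesis using that by blast
qed

section \<open>Elementary and diagonal matrices, and conjugation by them\<close>

definition mat_unit :: "'n \<Rightarrow> 'n \<Rightarrow> 'a::zero \<Rightarrow> 'a^'n^'n" where
  "mat_unit a b c = (\<chi> i j. if i = a \<and> j = b then c else 0)"

lemma mat_unit_nth [simp]: "mat_unit a b c $ i $ j = (if i = a \<and> j = b then c else 0)"
  by (simp add: mat_unit_def)

lemma mat_unit_mult_nth:
  fixes c :: "'a::semiring_1"
  shows "(mat_unit a b c ** X) $ i $ j = (if i = a then c * X $ b $ j else 0)"
by (simp add: matrix_matrix_mult_def if_distrib[of "(*) _"] if_distribR[of _ "(*) _" "(*) _"] if_distrib[of "\<lambda>x. x * _"] cong: if_cong)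

lemma mult_mat_unit_nth:
  fixes c :: "'a::semiring_1"
  shows "(X ** mat_unit a b c) $ i $ j = (if j = b then X $ i $ a * c else 0)"
by (simp add: matrix_matrix_mult_def if_distrib[of "(*) _"] if_distribR[of _ "(*) _" "(*) _"] if_distrib[of "\<lambda>x. x * _"] cong: if_cong)

abbreviation transvection :: "'n \<Rightarrow> 'n \<Rightarrow> 'a::comm_ring_1 \<Rightarrow> 'a^'n^'n" where
  "transvection a b c \<equiv> mat 1 + mat_unit a b c"

lemma det_transvection:
  assumes "a \<noteq> b"
  shows "det (transvection a b c) = 1"
proof -
  have "transvection a b c = (\<chi> k. if k = a then row a (mat 1) + c *s row b (mat 1) else row k (mat 1))"
    using assms by (auto simp: vec_eq_iff mat_def row_def)
  then show ?thesis using det_row_operation[OF assms, of "mat 1" c] by simp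
qed

lemma transvection_inverse:
  assumes "a \<noteq> b"
  shows "transvection a b c ** transvection a b (-c) = mat 1"
  using assms
  by (auto simp: vec_eq_iff matrix_add_ldistrib matrix_add_rdistrib mat_unit_mult_nth)

definition diag_mat :: "('n \<Rightarrow> 'a) \<Rightarrow> 'a::zero^'n^'n" where
  "diag_mat d = (\<chi> i j. if i = j then d i else 0)"

lemma diag_mat_nth [simp]: "diag_mat d $ i $ j = (if i = j then d i else 0)"
  by (simp add: diag_mat_def)

lemma diag_mat_mult_nth:
  fixes X :: "'a::semiring_1^'m^'n"
  shows "(diag_mat d ** X) $ i $ j = d i * X $ i $ j"
by (simp add: matrix_matrix_mult_def if_distrib[of "(*) _"] if_distribR[of _ "(*) _" "(*) _"] if_distrib[of "\<lambda>x. x * _"] cong: if_cong)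

lemma mult_diag_mat_nth:
  fixes X :: "'a::semiring_1^'n^'m"
  shows "(X ** diag_mat d) $ i $ j = X $ i $ j * d j"
by (simp add: matrix_matrix_mult_def if_distrib[of "(*) _"] if_distribR[of _ "(*) _" "(*) _"] if_distrib[of "\<lambda>x. x * _"] cong: if_cong)

text \<open>\<open>v\<close> stands for the inverse of \<open>u\<close>; carrying both avoids
  division in the ring, and swapping them gives the inverse matrix.\<close>

definition torus :: "'n \<Rightarrow> 'n \<Rightarrow> 'a \<Rightarrow> 'a \<Rightarrow> 'a::comm_ring_1^'n^'n" where
  "torus a b u v = diag_mat (\<lambda>i. if i = a then u else if i = b then v else 1)"

lemma det_torus:
  fixes u :: "'a::comm_ring_1" and a :: "'n::finite"
  assumes "a \<noteq> b" "u * v = 1"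
  shows "det (torus a b u v) = 1"
proof -
  have "det (torus a b u v) = (\<Prod>i\<in>UNIV. if i = a then u else if i = b then v else 1)"
    by (subst det_diagonal) (auto simp: torus_def)
  also have "\<dots> = (\<Prod>i\<in>{a, b}. if i = a then u else if i = b then v else 1)"
    by (rule prod.mono_neutral_right) auto
  finally show ?thesis using assms by simp
qed

lemma torus_inverse: "a \<noteq> b \<Longrightarrow> u * v = 1 \<Longrightarrow> torus a b u v ** torus a b v u = mat 1"
  by (auto simp: vec_eq_iff torus_def diag_mat_mult_nth mat_def mult.commute)

text \<open>With \<open>E\<close> the matrix unit at \<open>(a, b)\<close>, this is
  \<open>c E X - c X E - c^2 E X E\<close>: for distinct \<open>a\<close> and \<open>b\<close>, a
  conjugate of \<open>X\<close> by a transvection minus \<open>X\<close>. In entrywise form,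
  identities between iterated brackets reduce to case distinctions on indices.\<close>

definition bracket_transvection :: "'n \<Rightarrow> 'n \<Rightarrow> 'a \<Rightarrow> 'a::comm_ring_1^'n^'n \<Rightarrow> 'a^'n^'n" where
  "bracket_transvection a b c X = (\<chi> i j. (if i = a then c * X $ b $ j else 0)
     - (if j = b then c * X $ i $ a else 0) - (if i = a \<and> j = b then c\<^sup>2 * X $ b $ a else 0))"

lemma bracket_transvection_nth [simp]:
  "bracket_transvection a b c X $ i $ j = (if i = a then c * X $ b $ j else 0)
     - (if j = b then c * X $ i $ a else 0) - (if i = a \<and> j = b then c\<^sup>2 * X $ b $ a else 0)"
  by (simp add: bracket_transvection_def)

lemma bracket_transvection_eq:
  "transvection a b c ** X ** transvection a b (-c) - X = bracket_transvection a b c X"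
  by (auto simp: vec_eq_iff matrix_add_ldistrib matrix_add_rdistrib mat_unit_mult_nth
      mult_mat_unit_nth algebra_simps power2_eq_square)

definition conj_torus :: "'n \<Rightarrow> 'n \<Rightarrow> 'a \<Rightarrow> 'a \<Rightarrow> 'a::comm_ring_1^'n^'n \<Rightarrow> 'a^'n^'n" where
  "conj_torus a b u v X = (\<chi> i j. (if i = a then u else if i = b then v else 1) * X $ i $ j *
     (if j = a then v else if j = b then u else 1))"

lemma conj_torus_nth [simp]:
  "conj_torus a b u v X $ i $ j = (if i = a then u else if i = b then v else 1) * X $ i $ j *
     (if j = a then v else if j = b then u else 1)"
  by (simp add: conj_torus_def)

lemma conj_torus_eq: "torus a b u v ** X ** torus a b v u = conj_torus a b u v X"
  by (simp add: vec_eq_iff torus_def diag_mat_mult_nth mult_diag_mat_nth)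

section \<open>Determinants to first order\<close>

text \<open>A permutation other than the identity moves some \<open>i\<close> and then also
  \<open>p i\<close>, so its product has at least two off-diagonal factors.\<close>

lemma det_cong_diag:
  fixes A :: "'a::comm_ring_1^'n^'n"
  assumes "\<And>r s. r \<noteq> s \<Longrightarrow> d dvd A $ r $ s"
  shows "d * d dvd det A - (\<Prod>i\<in>UNIV. A $ i $ i)"
proof -
  let ?f = "\<lambda>p. of_int (sign p) * (\<Prod>i\<in>UNIV. A $ i $ p i)"
  have "det A = ?f id + (\<Sum>p\<in>{p. p permutes UNIV} - {id}. ?f p)"
    unfolding det_def by (rule sum.remove) (auto simp: permutes_id)
  moreover have "d * d dvd (\<Sum>p\<in>{p. p permutes UNIV} - {id}. ?f p)"
  proof (intro dvd_sum dvd_mult)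
    fix p :: "'n \<Rightarrow> 'n" assume "p \<in> {p. p permutes UNIV} - {id}"
    then have p: "p permutes UNIV" and "p \<noteq> id" by auto
    then obtain i where i: "p i \<noteq> i" by (auto simp: fun_eq_iff)
    then have j: "p (p i) \<noteq> p i" using permutes_inj[OF p] by (auto dest: injD)
    have "(\<Prod>k\<in>UNIV. A $ k $ p k) = A $ i $ p i * (A $ p i $ p (p i) * (\<Prod>k\<in>UNIV - {i} - {p i}. A $ k $ p k))"
      using i by (simp add: prod.remove[of UNIV i] prod.remove[of "UNIV - {i}" "p i"])
    then show "d * d dvd (\<Prod>k\<in>UNIV. A $ k $ p k)"
      using assms i j by (simp add: mult_dvd_mono dvd_mult2 flip: mult.assoc)
  qed
  ultimately show ?thesis by simp
qed

lemma prod_one_plus_cong: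
  fixes d :: "'a::comm_ring_1"
  assumes "finite S"
  shows "d * d dvd (\<Prod>i\<in>S. 1 + d * x i) - (1 + d * sum x S)"
  using assms
proof (induction S)
  case (insert a S)
  then obtain y where y: "(\<Prod>i\<in>S. 1 + d * x i) = 1 + d * sum x S + d * d * y"
    by (metis add_diff_cancel_left' diff_add_cancel dvd_def add.commute)
  have "(\<Prod>i\<in>insert a S. 1 + d * x i) - (1 + d * sum x (insert a S))
     = d * d * (y + x a * sum x S + d * x a * y)"
    using insert by (simp add: y algebra_simps)
  then show ?case by simp
qed simp

lemma det_one_plus_cong:
  fixes X :: "'a::comm_ring_1^'n^'n"
  shows "d * d dvd det (mat 1 + mat_scale d X) - (1 + d * trace X)"
proof -
  have 1: "d * d dvd det (mat 1 + mat_scale d X) - (\<Prod>i\<in>UNIV. 1 + d * X $ i $ i)"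
    using det_cong_diag[of d "mat 1 + mat_scale d X"] by (simp add: mat_def)
  have 2: "d * d dvd (\<Prod>i\<in>UNIV. 1 + d * X $ i $ i) - (1 + d * trace X)"
    unfolding trace_def by (rule prod_one_plus_cong) simp
  show ?thesis using dvd_add[OF 1 2] by (simp only: diff_add_cancel add_diff_eq)
qed

text \<open>The first-order term \<open>\<pi> ^ i * trace X\<close> of the determinant must be
  divisible by \<open>\<pi> ^ i * \<pi> ^ i\<close>, and one factor cancels. This confines the
  layers of \<open>SL\<close> to trace zero.\<close>

lemma trace_cong_of_det:
  fixes X :: "'a::idom^'n^'n"
  assumes "\<pi> \<noteq> 0" "i \<ge> 1" "det (mat 1 + mat_scale (\<pi> ^ i) X) = 1"
  shows "\<pi> dvd trace X"
proof -
  have "\<pi> ^ i * \<pi> ^ i dvd \<pi> ^ i * trace X"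
    using det_one_plus_cong[of "\<pi> ^ i" X] assms(3) by simp
  then have "\<pi> ^ i dvd trace X" using assms(1) by simp
  moreover have "\<pi> dvd \<pi> ^ i" using assms(2) by simp
  ultimately show ?thesis by (rule dvd_trans[rotated])
qed

section \<open>Conjugation-stable additive groups of matrices\<close>

locale finite_residue_dvr =
  fixes \<pi> :: "'a::idom"
  assumes uniformizer: "dvr_uniformizer \<pi>"
    and finite_residue: "finite (residue_classes \<pi>)"
    and card_residue: "card (residue_classes \<pi>) > 9"
begin

lemma uniformizer_nonzero: "\<pi> \<noteq> 0"
  and not_dvd_one: "\<not> \<pi> dvd 1"
  using uniformizer by (auto simp: dvr_uniformizer_def)

lemma unit_obtain:
  assumes "\<not> \<pi> dvd x"
  obtains v where "x * v = 1"
proof -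
  have "x \<noteq> 0" using assms by auto
  then obtain u m where u: "u dvd 1" "x = u * \<pi> ^ m"
    using uniformizer by (auto simp: dvr_uniformizer_def)
  have "m = 0" using assms u(2) by (cases m) auto
  then show ?thesis using that u by (auto simp: dvd_def)
qed

lemma not_dvd_unit: "x * v = 1 \<Longrightarrow> \<not> \<pi> dvd x"
  using not_dvd_one by (metis dvd_mult2)

lemma dvd_mult_iff: "\<pi> dvd x * y \<longleftrightarrow> \<pi> dvd x \<or> \<pi> dvd y"
proof (rule iffI)
  assume xy: "\<pi> dvd x * y"
  show "\<pi> dvd x \<or> \<pi> dvd y"
  proof (rule disjCI)
    assume "\<not> \<pi> dvd y"
    then obtain v where v: "y * v = 1" by (rule unit_obtain)
    have "\<pi> dvd x * y * v" using xy by (rule dvd_mult2)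
    then show "\<pi> dvd x" by (simp add: v mult.assoc)
  qed
qed auto

lemma residue_class_eq_iff: "{z. \<pi> dvd x - z} = {z. \<pi> dvd y - z} \<longleftrightarrow> \<pi> dvd x - y"
proof
  assume "{z. \<pi> dvd x - z} = {z. \<pi> dvd y - z}"
  then have "y \<in> {z. \<pi> dvd x - z}" by simp
  then show "\<pi> dvd x - y" by simp
next
  assume d: "\<pi> dvd x - y"
  show "{z. \<pi> dvd x - z} = {z. \<pi> dvd y - z}"
  proof (intro Collect_cong iffI)
    fix z
    show "\<pi> dvd y - z" if "\<pi> dvd x - z" using dvd_diff[OF that d] by simp
    show "\<pi> dvd x - z" if "\<pi> dvd y - z" using dvd_add[OF that d] by simp
  qed
qed

text \<open>The bound on the residue field enters here: parameters of conjugating matrices are later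
  chosen outside a short list of bad residues.\<close>

lemma avoid_residues:
  assumes "finite F" "card F \<le> 9"
  obtains x where "\<And>f. f \<in> F \<Longrightarrow> \<not> \<pi> dvd x - f"
proof (rule ccontr)
  let ?cls = "\<lambda>x. {y. \<pi> dvd x - y}"
  assume "\<not> thesis"
  then have *: "\<exists>f\<in>F. \<pi> dvd x - f" for x using that by blast
  have "residue_classes \<pi> \<subseteq> ?cls ` F"
  proof
    fix C assume "C \<in> residue_classes \<pi>"
    then obtain x where C: "C = ?cls x" by (auto simp: residue_classes_def)
    obtain f where f: "f \<in> F" "\<pi> dvd x - f" using * by blast
    then have "?cls x = ?cls f" by (simp only: residue_class_eq_iff)
    then show "C \<in> ?cls ` F" using C f by auto
  qed
  then have "card (residue_classes \<pi>) \<le> card F"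
    using assms(1) by (meson card_image_le card_mono finite_imageI le_trans)
  then show False using assms(2) card_residue by simp
qed

lemma square_mod:
  assumes "\<pi> dvd 2"
  obtains a where "\<pi> dvd a\<^sup>2 - x"
proof -
  let ?cls = "\<lambda>x. {y. \<pi> dvd x - y}"
  \<comment> \<open>In characteristic 2 squaring is additive, hence injective on the finite residue field.\<close>
  define rep where "rep C = (SOME x. C = ?cls x)" for C
  have rep: "?cls (rep C) = C" if "C \<in> residue_classes \<pi>" for C
  proof -
    have "\<exists>x. C = ?cls x" using that by (auto simp: residue_classes_def)
    then have "C = ?cls (rep C)" unfolding rep_def by (rule someI_ex)
    then show ?thesis by simp
  qed
  define sq where "sq C = ?cls ((rep C)\<^sup>2)" for C
  have "inj_on sq (residue_classes \<pi>)"
  proof (rule inj_onI)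
    fix C D assume CD: "C \<in> residue_classes \<pi>" "D \<in> residue_classes \<pi>" "sq C = sq D"
    have "\<pi> dvd (rep C)\<^sup>2 - (rep D)\<^sup>2" using CD(3) unfolding sq_def by (simp only: residue_class_eq_iff)
    \<comment> \<open>Modulo 2 the difference of the squares is the square of the
      difference.\<close>
    then have "\<pi> dvd (rep C)\<^sup>2 - (rep D)\<^sup>2 - 2 * (rep D * (rep C - rep D))"
      by (rule dvd_diff) (intro dvd_mult2 assms)
    also have "\<dots> = (rep C - rep D) * (rep C - rep D)"
      by (simp add: algebra_simps power2_eq_square)
    finally have "\<pi> dvd rep C - rep D" by (simp add: dvd_mult_iff)
    then have "?cls (rep C) = ?cls (rep D)" by (simp only: residue_class_eq_iff)
    then show "C = D" using rep CD by simp
  qed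
  moreover have "sq ` residue_classes \<pi> \<subseteq> residue_classes \<pi>"
    by (auto simp: sq_def residue_classes_def)
  ultimately have "sq ` residue_classes \<pi> = residue_classes \<pi>"
    using finite_residue by (simp add: endo_inj_surj)
  moreover have "?cls x \<in> residue_classes \<pi>" by (auto simp: residue_classes_def)
  ultimately obtain C where "?cls x = sq C" by blast
  then have "?cls ((rep C)\<^sup>2) = ?cls x" by (simp add: sq_def)
  then show ?thesis using that by (simp only: residue_class_eq_iff)
qed

end

text \<open>By \<open>cong_mem\<close> the set \<open>M\<close> is a union of residue classes, so it
  encodes a conjugation-stable additive group of matrices over \<open>k\<close> without constructing
  \<open>k\<close>. Closure under scalars has to be derived from conjugation.\<close>

locale adjoint_module = finite_residue_dvr \<pi> for \<pi> :: "'a::idom" +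
  fixes M :: "('a^'n^'n) set"
  assumes add_mem: "X \<in> M \<Longrightarrow> Y \<in> M \<Longrightarrow> X + Y \<in> M"
    and uminus_mem: "X \<in> M \<Longrightarrow> - X \<in> M"
    and cong_mem: "X \<in> M \<Longrightarrow> mat_cong \<pi> 1 X Y \<Longrightarrow> Y \<in> M"
    and conj_mem: "X \<in> M \<Longrightarrow> det A = 1 \<Longrightarrow> A ** B = mat 1 \<Longrightarrow> B ** A = mat 1 \<Longrightarrow> A ** X ** B \<in> M"
    and zero_mem: "0 \<in> M"
begin

lemma diff_mem: "X \<in> M \<Longrightarrow> Y \<in> M \<Longrightarrow> X - Y \<in> M"
  using add_mem[of X "-Y"] uminus_mem by simp

lemma sum_mem: "(\<And>i. i \<in> S \<Longrightarrow> f i \<in> M) \<Longrightarrow> sum f S \<in> M"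
  by (induction S rule: infinite_finite_induct) (auto intro: zero_mem add_mem)

lemma transvection_mem:
  assumes "X \<in> M" "a \<noteq> b"
  shows "bracket_transvection a b c X \<in> M"
proof -
  have "transvection a b c ** X ** transvection a b (-c) \<in> M"
    using assms transvection_inverse[of a b c] transvection_inverse[of a b "-c"]
    by (intro conj_mem det_transvection) simp_all
  then have "transvection a b c ** X ** transvection a b (-c) - X \<in> M"
    using assms(1) by (rule diff_mem)
  then show ?thesis by (simp only: bracket_transvection_eq)
qed

lemma torus_mem:
  assumes "X \<in> M" "a \<noteq> b" "u * v = 1"
  shows "conj_torus a b u v X \<in> M"
proof -
  have "torus a b u v ** X ** torus a b v u \<in> M"
    using assms torus_inverse[of a b u v] torus_inverse[of a b v u]
    by (intro conj_mem det_torus) (simp_all add: mult.commute)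
  then show ?thesis by (simp only: conj_torus_eq)
qed

lemma mat_unit_diff_mem:
  assumes "mat_unit a b x \<in> M" "mat_unit a b y \<in> M"
  shows "mat_unit a b (x - y) \<in> M"
proof -
  have "mat_unit a b (x - y) = mat_unit a b x - mat_unit a b y"
    by (simp add: vec_eq_iff)
  then show ?thesis using diff_mem[OF assms] by simp
qed

lemma mat_unit_cong_mem:
  assumes "mat_unit a b x \<in> M" "\<pi> dvd x - y"
  shows "mat_unit a b y \<in> M"
  using assms(1) by (rule cong_mem) (use assms(2) in \<open>auto intro: mat_congI\<close>)

text \<open>Conjugation by the torus element with entries \<open>c\<close> and its inverse scales
  this matrix unit by \<open>c^2\<close>, which supplies the first scalars acting on
  \<open>M\<close>.\<close>

lemma mat_unit_square_mem:
  assumes "mat_unit a b x \<in> M" "a \<noteq> b"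
  shows "mat_unit a b (c\<^sup>2 * x) \<in> M"
proof (cases "\<pi> dvd c")
  case True
  have "mat_unit a b 0 = (0 :: 'a^'n^'n)" by (simp add: vec_eq_iff)
  then have "mat_unit a b 0 \<in> M" using zero_mem by simp
  then show ?thesis by (rule mat_unit_cong_mem) (use True in \<open>simp add: power2_eq_square\<close>)
next
  case False
  then obtain v where v: "c * v = 1" by (rule unit_obtain)
  have "mat_unit a b (c\<^sup>2 * x) = conj_torus a b c v (mat_unit a b x)"
    using assms(2) by (auto simp: vec_eq_iff power2_eq_square)
  then show ?thesis using torus_mem[OF assms v] by simp
qed

text \<open>
  Every residue is a difference of two squares, or, in residue characteristic 2, a square.
\<close>
lemma mat_unit_scale_mem:
  assumes "mat_unit a b x \<in> M" "a \<noteq> b"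
  shows "mat_unit a b (c * x) \<in> M"
proof (cases "\<pi> dvd 2")
  case True
  obtain d where "\<pi> dvd d\<^sup>2 - c" using square_mod[OF True] by blast
  then have "\<pi> dvd d\<^sup>2 * x - c * x" by (simp add: dvd_mult2 flip: left_diff_distrib)
  then show ?thesis using mat_unit_square_mem[OF assms, of d] mat_unit_cong_mem by blast
next
  case False
  then obtain h :: 'a where h: "2 * h = 1" by (rule unit_obtain)
  have "mat_unit a b (((c + 1) * h)\<^sup>2 * x - ((c - 1) * h)\<^sup>2 * x) \<in> M"
    by (intro mat_unit_diff_mem mat_unit_square_mem assms)
  also have "((c + 1) * h)\<^sup>2 * x - ((c - 1) * h)\<^sup>2 * x = c * x * (2 * h)\<^sup>2"
    by (simp add: power2_eq_square algebra_simps)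
  finally show ?thesis by (simp add: h)
qed

lemma mat_unit_unit_mem:
  assumes "mat_unit a b x \<in> M" "a \<noteq> b" "\<not> \<pi> dvd x"
  shows "mat_unit a b y \<in> M"
proof -
  obtain v where v: "x * v = 1" using assms(3) by (rule unit_obtain)
  have "mat_unit a b (y * v * x) \<in> M" using assms(1,2) by (rule mat_unit_scale_mem)
  also have "y * v * x = y" using v by (simp add: mult.assoc mult.commute[of v])
  finally show ?thesis .
qed

text \<open>If \<open>X\<close> is diagonal modulo \<open>\<pi>\<close>, being non-scalar means that
  two diagonal entries differ; a bracket moves their difference off the diagonal.\<close>

lemma off_diagonal_entry:
  assumes X: "X \<in> M" and ns: "\<And>c. \<not> mat_cong \<pi> 1 X (mat c)"
  obtains Y r s where "Y \<in> M" "r \<noteq> s" "\<not> \<pi> dvd Y $ r $ s"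
proof (cases "\<exists>r s. r \<noteq> s \<and> \<not> \<pi> dvd X $ r $ s")
  case True
  then show ?thesis using that X by blast
next
  case False
  then have off: "\<pi> dvd X $ r $ s" if "r \<noteq> s" for r s using that by blast
  fix r0 :: 'n
  obtain s where s: "\<not> \<pi> dvd X $ s $ s - X $ r0 $ r0"
  proof (rule ccontr)
    assume "\<not> thesis"
    then have "\<pi> dvd X $ s $ s - X $ r0 $ r0" for s using that by blast
    then have "mat_cong \<pi> 1 X (mat (X $ r0 $ r0))"
      using off by (auto simp: mat_cong_def mat_def)
    then show False using ns by blast
  qed
  then have ne: "r0 \<noteq> s" by auto
  let ?Y = "bracket_transvection r0 s 1 X"
  have "?Y \<in> M" using transvection_mem[OF X ne] .
  moreover have "\<not> \<pi> dvd ?Y $ r0 $ s"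
  proof
    assume "\<pi> dvd ?Y $ r0 $ s"
    then have "\<pi> dvd ?Y $ r0 $ s + X $ s $ r0" using off ne by (intro dvd_add) auto
    then show False using s by simp
  qed
  ultimately show ?thesis using that ne by blast
qed

text \<open>The first bracket is supported on row \<open>s\<close> and column \<open>r\<close>. The
  second leaves \<open>- X $ k $ s\<close> at \<open>(s, r)\<close> and \<open>- X $ r $ s\<close>
  at \<open>(s, k)\<close>. The third removes the former and carries the latter to
  \<open>(s, r)\<close> with reversed sign.\<close>

lemma mat_unit_from_entry_ge_3:
  assumes X: "X \<in> M" and rs: "r \<noteq> s" and k: "k \<noteq> r" "k \<noteq> s"
  shows "mat_unit s r (X $ r $ s) \<in> M"
proof -
  have "mat_unit s r (X $ r $ s) =
    bracket_transvection k r 1 (bracket_transvection s k 1 (bracket_transvection s r 1 X))"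
    using rs k by (auto simp: vec_eq_iff)
  also have "\<dots> \<in> M" using X rs k by (intro transvection_mem) auto
  finally show ?thesis .
qed

text \<open>
  The torus fixes diagonal entries and multiplies the (s,r) entry by u^2, so for n = 2 subtracting
  isolates that entry.
\<close>
lemma mat_unit_from_entry_2:
  assumes X: "X \<in> M" and rs: "r \<noteq> s" and two: "\<And>k. k = r \<or> k = s" and uv: "u * v = 1"
  shows "mat_unit s r ((u\<^sup>2 - 1) * (c * (X $ r $ r - X $ s $ s) - c\<^sup>2 * X $ r $ s)) \<in> M"
proof -
  \<comment> \<open>The bracket is supported on row \<open>s\<close> and column \<open>r\<close>, so
    its \<open>(r, s)\<close> entry is already zero.\<close>
  let ?Y = "bracket_transvection s r c X"
  have "?Y \<in> M" using X rs by (intro transvection_mem) auto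
  then have "conj_torus s r u v ?Y - ?Y \<in> M" (is "?Z - ?Y \<in> M")
    using rs uv by (intro diff_mem torus_mem) auto
  also have "?Z - ?Y = mat_unit s r ((u\<^sup>2 - 1) * (c * (X $ r $ r - X $ s $ s) - c\<^sup>2 * X $ r $ s))"
  proof (unfold vec_eq_iff, intro allI)
    fix i j
    have uv': "u * (x * v) = x" "v * (x * u) = x" for x
      using uv by (simp_all add: mult.left_commute mult.commute)
    have "(i = s \<or> i = r) \<and> (j = s \<or> j = r)" using two by blast
    then show "(?Z - ?Y) $ i $ j
      = mat_unit s r ((u\<^sup>2 - 1) * (c * (X $ r $ r - X $ s $ s) - c\<^sup>2 * X $ r $ s)) $ i $ j"
      using rs uv' by (elim conjE disjE) (auto simp: algebra_simps power2_eq_square)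
  qed
  finally show ?thesis .
qed

lemma obtain_mat_unit:
  assumes X: "X \<in> M" and rs: "r \<noteq> s" and x: "\<not> \<pi> dvd X $ r $ s"
  obtains y where "\<not> \<pi> dvd y" "mat_unit s r y \<in> M"
proof (cases "\<exists>k. k \<noteq> r \<and> k \<noteq> s")
  case True
  then show ?thesis using mat_unit_from_entry_ge_3[OF X rs] that x by blast
next
  case False
  then have two: "k = r \<or> k = s" for k by blast
  \<comment> \<open>Avoiding 0, 1 and -1 makes both \<open>u\<close> and \<open>u^2 - 1\<close>
    units.\<close>
  obtain u where u: "\<not> \<pi> dvd u - f" if "f \<in> {0, 1, -1}" for f
    by (rule avoid_residues[of "{0, 1, -1}"]) (auto simp: card_insert_if)
  obtain v where uv: "u * v = 1" using u[of 0] unit_obtain by auto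
  have "\<not> \<pi> dvd (u - 1) * (u + 1)" using u[of 1] u[of "-1"] by (simp add: dvd_mult_iff)
  then have u2: "\<not> \<pi> dvd u\<^sup>2 - 1" by (simp add: algebra_simps power2_eq_square)
  \<comment> \<open>\<open>?g\<close> is affine in \<open>c\<close> with unit slope, hence zero in
    at most one residue class; if 1 lies in it, any other nonzero residue works.\<close>
  let ?g = "\<lambda>c. X $ r $ r - X $ s $ s - c * X $ r $ s"
  obtain c where c: "\<not> \<pi> dvd c" "\<not> \<pi> dvd ?g c"
  proof (cases "\<pi> dvd ?g 1")
    case True
    obtain c where c: "\<not> \<pi> dvd c - f" if "f \<in> {0, 1}" for f
      by (rule avoid_residues[of "{0, 1}"]) (auto simp: card_insert_if)
    have "\<not> \<pi> dvd ?g c"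
    proof
      assume "\<pi> dvd ?g c"
      with True have "\<pi> dvd ?g 1 - ?g c" by (rule dvd_diff)
      also have "?g 1 - ?g c = (c - 1) * X $ r $ s" by (simp add: algebra_simps)
      finally show False using c[of 1] x by (simp add: dvd_mult_iff)
    qed
    then show ?thesis using that c[of 0] by simp
  next
    case False
    then show ?thesis using that[of 1] not_dvd_one by simp
  qed
  have "\<not> \<pi> dvd (u\<^sup>2 - 1) * (c * ?g c)" using u2 c by (simp add: dvd_mult_iff)
  also have "c * ?g c = c * (X $ r $ r - X $ s $ s) - c\<^sup>2 * X $ r $ s"
    by (simp add: algebra_simps power2_eq_square)
  finally show ?thesis using that mat_unit_from_entry_2[OF X rs two uv] by blast
qed

text \<open>The bracket of the given matrix unit has a diagonal part linear in \<open>c\<close> and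
  an \<open>(s, r)\<close> entry quadratic in \<open>c\<close>. Two choices with the same product
  \<open>c * y\<close> share the diagonal part, so their difference isolates the entry.\<close>

lemma mat_unit_swap:
  assumes M: "\<And>y. mat_unit r s y \<in> M" and rs: "r \<noteq> s"
  shows "mat_unit s r y \<in> M" and "mat_unit s s y - mat_unit r r y \<in> M"
proof -
  let ?Y = "\<lambda>c y. mat_unit s s (c * y) - mat_unit r r (c * y) - mat_unit s r (c\<^sup>2 * y)"
  have Y: "?Y c y \<in> M" for c y
  proof -
    have "?Y c y = bracket_transvection s r c (mat_unit r s y)"
      using rs by (auto simp: vec_eq_iff)
    also have "\<dots> \<in> M" using M rs by (intro transvection_mem) auto
    finally show ?thesis .
  qed
  obtain c where c: "\<not> \<pi> dvd c - f" if "f \<in> {0, 1}" for f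
    by (rule avoid_residues[of "{0, 1}"]) (auto simp: card_insert_if)
  have "?Y 1 c - ?Y c 1 \<in> M" by (intro diff_mem Y)
  also have "?Y 1 c - ?Y c 1 = mat_unit s r (c * (c - 1))"
    by (auto simp: vec_eq_iff algebra_simps power2_eq_square)
  finally have "mat_unit s r (c * (c - 1)) \<in> M" .
  moreover have "\<not> \<pi> dvd c * (c - 1)" using c[of 0] c[of 1] by (simp add: dvd_mult_iff)
  ultimately have sr: "mat_unit s r z \<in> M" for z using rs mat_unit_unit_mem by metis
  show "mat_unit s r y \<in> M" by (rule sr)
  have "?Y 1 y + mat_unit s r y \<in> M" by (intro add_mem Y sr)
  then show "mat_unit s s y - mat_unit r r y \<in> M" by simp
qed

lemma mat_unit_row:
  assumes M: "\<And>y. mat_unit r s y \<in> M" and "r \<noteq> s" "a \<noteq> s"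
  shows "mat_unit a s y \<in> M"
proof (cases "a = r")
  case False
  have "mat_unit a s y = bracket_transvection a r 1 (mat_unit r s y)"
    using assms False by (auto simp: vec_eq_iff)
  also have "\<dots> \<in> M" using M False by (intro transvection_mem) auto
  finally show ?thesis .
qed (use M in simp)

text \<open>Moving the row index fills column \<open>s\<close>, \<open>mat_unit_swap\<close>
  transposes this to row \<open>s\<close>, and moving the row index again reaches the remaining
  positions.\<close>

lemma mat_unit_all:
  assumes M: "\<And>y. mat_unit r s y \<in> M" and rs: "r \<noteq> s" and ab: "a \<noteq> b"
  shows "mat_unit a b y \<in> M"
proof -
  have col: "mat_unit a s y \<in> M" if "a \<noteq> s" for a y using mat_unit_row[OF M rs that] .
  have row: "mat_unit s b y \<in> M" if "b \<noteq> s" for b y using mat_unit_swap(1)[OF col that] that by simp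
  show ?thesis
  proof (cases "b = s")
    case False
    show ?thesis
    proof (cases "a = s")
      case False
      then show ?thesis using mat_unit_row[OF row, of b a] \<open>b \<noteq> s\<close> ab by auto
    qed (use row False in simp)
  qed (use col ab in simp)
qed

proposition trace_zero_mem:
  assumes X: "X \<in> M" and ns: "\<And>c. \<not> mat_cong \<pi> 1 X (mat c)" and Y: "\<pi> dvd trace Y"
  shows "Y \<in> M"
proof -
  obtain Z r s where "Z \<in> M" "r \<noteq> s" "\<not> \<pi> dvd Z $ r $ s"
    using off_diagonal_entry[OF X ns] by blast
  then obtain y where "\<not> \<pi> dvd y" "mat_unit s r y \<in> M" using obtain_mat_unit by blast
  then have "mat_unit s r z \<in> M" for z using mat_unit_unit_mem \<open>r \<noteq> s\<close> by metis
  then have mu: "mat_unit a b z \<in> M" if "a \<noteq> b" for a b z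
    using mat_unit_all \<open>r \<noteq> s\<close> that by metis
  \<comment> \<open>The diagonal is expanded in differences from the base position
    \<open>(r, r)\<close>. The sum then differs from \<open>Y\<close> only there, by
    \<open>trace Y\<close>, which is zero modulo \<open>\<pi>\<close>.\<close>
  let ?F = "\<lambda>i j. if i = j then mat_unit i i (Y $ i $ i) - mat_unit r r (Y $ i $ i)
    else mat_unit i j (Y $ i $ j)"
  have "(\<Sum>i\<in>UNIV. \<Sum>j\<in>UNIV. ?F i j) \<in> M"
  proof (intro sum_mem)
    fix i j
    show "?F i j \<in> M"
    proof (cases "i = j \<and> i \<noteq> r")
      case True
      then have "mat_unit i i (Y $ i $ i) - mat_unit r r (Y $ i $ i) \<in> M"
        using mat_unit_swap(2)[OF mu, of r i] by auto
      then show ?thesis using True by simp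
    qed (use mu zero_mem in auto)
  qed
  moreover have "mat_cong \<pi> 1 (\<Sum>i\<in>UNIV. \<Sum>j\<in>UNIV. ?F i j) Y"
  proof (rule mat_congI)
    fix a b
    have F: "?F i j $ a $ b = (if a = i then if b = j then Y $ i $ j else 0 else 0)
       - (if i = j then if a = r \<and> b = r then Y $ i $ i else 0 else 0)" for i j by auto
    have "(\<Sum>i\<in>UNIV. \<Sum>j\<in>UNIV. ?F i j) $ a $ b = Y $ a $ b
       - (if a = r \<and> b = r then trace Y else 0)"
    proof -
      have "(\<Sum>j\<in>UNIV. if a = i then if b = j then Y $ i $ j else 0 else 0)
          = (if a = i then Y $ i $ b else 0)"
        and "(\<Sum>j\<in>UNIV. if i = j then if a = r \<and> b = r then Y $ i $ i else 0 else 0)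
          = (if a = r \<and> b = r then Y $ i $ i else 0)" for i
        by simp_all
      then show ?thesis
        by (simp only: sum_component F sum_subtractf) (auto simp: trace_def)
    qed
    then show "\<pi> ^ 1 dvd (\<Sum>i\<in>UNIV. \<Sum>j\<in>UNIV. ?F i j) $ a $ b - Y $ a $ b"
      using Y by simp
  qed
  ultimately show ?thesis by (rule cong_mem)
qed

end

section \<open>Layers of the subgroup\<close>

lemma not_scalar_of_entry:
  assumes "r \<noteq> s" "\<not> \<pi> dvd X $ r $ s"
  shows "\<not> mat_cong \<pi> 1 X (mat c)"
  using assms mat_congD[of \<pi> 1 X "mat c" r s] by (auto simp: mat_def)

text \<open>The lifting error of \<open>h'\<close> is commuted with \<open>A\<close>, the identity
  modulo \<open>\<pi>\<close>, and drops out. \<open>B\<close> need not be near the identity, so the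
  error \<open>Y\<close> of \<open>h\<close> survives.\<close>

lemma commutator_cong:
  fixes A B Y h' :: "'a::idom^'n^'n"
  assumes i: "i \<ge> 1" and A: "mat_cong \<pi> 1 A (mat 1)" and h': "mat_cong \<pi> i h' B"
  defines "h \<equiv> A + mat_scale (\<pi> ^ i) Y"
  shows "mat_cong \<pi> (i + 1) (h ** h' - h' ** h) (A ** B - B ** A + mat_scale (\<pi> ^ i) (Y ** B - B ** Y))"
proof -
  obtain Z where Z: "h' = B + mat_scale (\<pi> ^ i) Z" using h' by (rule mat_cong_obtain)
  have e: "h ** h' - h' ** h = (A ** B - B ** A + mat_scale (\<pi> ^ i) (Y ** B - B ** Y))
     + mat_scale (\<pi> ^ i) (A ** Z - Z ** A) + mat_scale (\<pi> ^ (i + i)) (Y ** Z - Z ** Y)"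
    by (simp add: h_def Z matrix_add_ldistrib matrix_add_rdistrib mat_scale_mult_left mat_scale_mult_right)
      (simp add: vec_eq_iff algebra_simps power_add)
  have "mat_cong \<pi> 1 (A ** Z - Z ** A) (mat 1 ** Z - Z ** mat 1)"
    by (intro mat_cong_diff mat_cong_mult A mat_cong_refl)
  then have "mat_cong \<pi> (i + 1) (mat_scale (\<pi> ^ i) (A ** Z - Z ** A)) (mat_scale (\<pi> ^ i) 0)"
    by (intro mat_cong_scale) simp
  moreover have "mat_scale (\<pi> ^ i) 0 = (0 :: 'a^'n^'n)" by (simp add: vec_eq_iff)
  ultimately have 1: "mat_cong \<pi> (i + 1) (mat_scale (\<pi> ^ i) (A ** Z - Z ** A)) 0" by simp
  have 2: "mat_cong \<pi> (i + 1) (mat_scale (\<pi> ^ (i + i)) (Y ** Z - Z ** Y)) 0"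
    using i by (intro mat_cong_scale_zero) simp
  show ?thesis
    using mat_cong_add[OF mat_cong_add[OF mat_cong_refl 1] 2] e by simp
qed

locale sl_subgroup = finite_residue_dvr \<pi> for \<pi> :: "'a::idom" +
  fixes H :: "('a^'n^'n) set"
  assumes subgroup: "is_subgroup_SL H"
    and reduction: "reduction_is_SL \<pi> H"
begin

lemma one_mem: "mat 1 \<in> H" and mult_mem: "g \<in> H \<Longrightarrow> h \<in> H \<Longrightarrow> g ** h \<in> H"
  and det_mem: "h \<in> H \<Longrightarrow> det h = 1"
  using subgroup by (auto simp: is_subgroup_SL_def SL_def)

lemma inverse_obtain:
  assumes "h \<in> H"
  obtains g where "g \<in> H" "h ** g = mat 1" "g ** h = mat 1"
proof -
  obtain g where g: "g \<in> H" "h ** g = mat 1"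
    using assms subgroup unfolding is_subgroup_SL_def by blast
  obtain f where f: "g ** f = mat 1"
    using g(1) subgroup unfolding is_subgroup_SL_def by blast
  have "h = h ** (g ** f)" using f by simp
  also have "\<dots> = f" by (simp add: matrix_mul_assoc g(2))
  finally show ?thesis using that g f by simp
qed

text \<open>For i > 0 this is the preimage of H^[i] in the matrices over R.\<close>
definition level :: "nat \<Rightarrow> ('a^'n^'n) set" where
  "level i = {X. \<exists>h\<in>H. mat_cong \<pi> (i + 1) h (mat 1 + mat_scale (\<pi> ^ i) X)}"

definition surj_mod :: "nat \<Rightarrow> bool" where
  "surj_mod i \<longleftrightarrow> (\<forall>B. det B = 1 \<longrightarrow> (\<exists>h\<in>H. mat_cong \<pi> i h B))"

lemma surj_mod_1: "surj_mod 1"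
  using reduction by (simp add: surj_mod_def reduction_is_SL_def)

text \<open>Products near the identity add leading terms, because \<open>2 * i\<close> is at least
  \<open>i + 1\<close>. Conjugation depends on the conjugating matrix only modulo
  \<open>\<pi>\<close>, so an element of \<open>H\<close> can stand in for any \<open>A\<close> of
  determinant 1.\<close>

lemma adjoint_module_level:
  assumes i: "i \<ge> 1"
  shows "adjoint_module \<pi> (level i)"
proof unfold_locales
  have double: "mat_cong \<pi> (i + 1) (mat_scale (\<pi> ^ (i + i)) X) 0" for X :: "'a^'n^'n"
    using i by (intro mat_cong_scale_zero) simp
  have prod: "mat_cong \<pi> (i + 1)
      ((mat 1 + mat_scale (\<pi> ^ i) X) ** (mat 1 + mat_scale (\<pi> ^ i) Y))
      (mat 1 + mat_scale (\<pi> ^ i) (X + Y))" for X Y :: "'a^'n^'n"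
  proof -
    have "(mat 1 + mat_scale (\<pi> ^ i) X) ** (mat 1 + mat_scale (\<pi> ^ i) Y)
      = mat 1 + mat_scale (\<pi> ^ i) (X + Y) + mat_scale (\<pi> ^ (i + i)) (X ** Y)"
      by (simp add: matrix_add_ldistrib matrix_add_rdistrib mat_scale_mult_left mat_scale_mult_right)
        (simp add: vec_eq_iff algebra_simps power_add)
    then show ?thesis using mat_cong_add[OF mat_cong_refl double] by simp
  qed
  show "X + Y \<in> level i" if "X \<in> level i" "Y \<in> level i" for X Y
  proof -
    obtain g h where "g \<in> H" "mat_cong \<pi> (i + 1) g (mat 1 + mat_scale (\<pi> ^ i) X)"
      and "h \<in> H" "mat_cong \<pi> (i + 1) h (mat 1 + mat_scale (\<pi> ^ i) Y)"
      using \<open>X \<in> level i\<close> \<open>Y \<in> level i\<close> unfolding level_def by blast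
    then have "g ** h \<in> H" "mat_cong \<pi> (i + 1) (g ** h) (mat 1 + mat_scale (\<pi> ^ i) (X + Y))"
      using mult_mem mat_cong_trans[OF mat_cong_mult prod] by blast+
    then show ?thesis unfolding level_def by blast
  qed
  show "- X \<in> level i" if X: "X \<in> level i" for X
  proof -
    obtain h where h: "h \<in> H" "mat_cong \<pi> (i + 1) h (mat 1 + mat_scale (\<pi> ^ i) X)"
      using X by (auto simp: level_def)
    obtain g where g: "g \<in> H" "g ** h = mat 1" using inverse_obtain[OF h(1)] by metis
    \<comment> \<open>\<open>?N\<close> inverts \<open>h\<close> modulo
      \<open>\<pi> ^ (i + 1)\<close>, hence is congruent to the true inverse
      \<open>g\<close>.\<close>
    let ?N = "mat 1 + mat_scale (\<pi> ^ i) (- X)"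
    have "mat_cong \<pi> (i + 1) (h ** ?N) (mat 1 + mat_scale (\<pi> ^ i) (X + - X))"
      using mat_cong_trans[OF mat_cong_mult_right[OF h(2)] prod] .
    also have "mat 1 + mat_scale (\<pi> ^ i) (X + - X) = mat 1" by (simp add: vec_eq_iff)
    finally have "mat_cong \<pi> (i + 1) (g ** (h ** ?N)) (g ** mat 1)" by (rule mat_cong_mult_left)
    then have "mat_cong \<pi> (i + 1) ?N g" by (simp add: matrix_mul_assoc g(2))
    then show ?thesis unfolding level_def using g(1) mat_cong_sym by blast
  qed
  show "Y \<in> level i" if "X \<in> level i" "mat_cong \<pi> 1 X Y" for X Y
  proof -
    have "mat_cong \<pi> (i + 1) (mat 1 + mat_scale (\<pi> ^ i) X) (mat 1 + mat_scale (\<pi> ^ i) Y)"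
      by (intro mat_cong_add mat_cong_refl mat_cong_scale that)
    then show ?thesis using that(1) unfolding level_def by (auto intro: mat_cong_trans)
  qed
  show "A ** X ** B \<in> level i"
    if X: "X \<in> level i" and A: "det A = 1" "A ** B = mat 1" "B ** A = mat 1" for X A B
  proof -
    obtain h where h: "h \<in> H" "mat_cong \<pi> (i + 1) h (mat 1 + mat_scale (\<pi> ^ i) X)"
      using X by (auto simp: level_def)
    obtain a where a: "a \<in> H" "mat_cong \<pi> 1 a A"
      using surj_mod_1 A(1) by (auto simp: surj_mod_def)
    obtain b where b: "b \<in> H" "a ** b = mat 1" "b ** a = mat 1" using inverse_obtain[OF a(1)] .
    have "mat_cong \<pi> 1 (b ** a ** B) (b ** A ** B)"
      by (intro mat_cong_mult_right mat_cong_mult_left a)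
    then have bB: "mat_cong \<pi> 1 b B"
      by (simp add: b A flip: matrix_mul_assoc) (erule mat_cong_sym)
    have "mat_cong \<pi> (i + 1) (a ** h ** b) (a ** (mat 1 + mat_scale (\<pi> ^ i) X) ** b)"
      by (intro mat_cong_mult_right mat_cong_mult_left h)
    also have "a ** (mat 1 + mat_scale (\<pi> ^ i) X) ** b = mat 1 + mat_scale (\<pi> ^ i) (a ** X ** b)"
      by (simp add: matrix_add_ldistrib matrix_add_rdistrib mat_scale_mult_left mat_scale_mult_right b)
    also have "mat_cong \<pi> (i + 1) \<dots> (mat 1 + mat_scale (\<pi> ^ i) (A ** X ** B))"
      by (intro mat_cong_add mat_cong_refl mat_cong_scale mat_cong_mult a bB)
    finally show ?thesis unfolding level_def using mult_mem a(1) h(1) b(1) by blast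
  qed
  show "0 \<in> level i"
  proof -
    have "mat 1 + mat_scale (\<pi> ^ i) 0 = (mat 1 :: 'a^'n^'n)" by (simp add: vec_eq_iff)
    then show ?thesis using one_mem by (force simp: level_def)
  qed
qed

text \<open>An approximation \<open>h\<close> of \<open>B\<close> is off by a factor
  \<open>1 + \<pi> ^ i Y\<close>. Determinants force the trace of \<open>Y\<close> to vanish modulo
  \<open>\<pi>\<close>, so \<open>Y\<close> lies in the layer and some \<open>k\<close> in
  \<open>H\<close> corrects \<open>h\<close>.\<close>

lemma surj_mod_Suc:
  assumes i: "i \<ge> 1" and surj: "surj_mod i"
    and X: "X \<in> level i" "\<And>c. \<not> mat_cong \<pi> 1 X (mat c)"
  shows "surj_mod (Suc i)"
  unfolding surj_mod_def
proof (intro allI impI)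
  fix B :: "'a^'n^'n" assume B: "det B = 1"
  obtain h where h: "h \<in> H" "mat_cong \<pi> i h B" using surj B by (auto simp: surj_mod_def)
  obtain g where g: "g \<in> H" "h ** g = mat 1" "g ** h = mat 1" using inverse_obtain[OF h(1)] .
  have "mat_cong \<pi> i (g ** h) (g ** B)" using h(2) by (rule mat_cong_mult_left)
  then have "mat_cong \<pi> i (g ** B) (mat 1)" by (simp add: g mat_cong_sym)
  then obtain Y where Y: "g ** B = mat 1 + mat_scale (\<pi> ^ i) Y" by (rule mat_cong_obtain)
  have "det (g ** B) = 1" by (simp add: det_mul B det_mem g)
  then have "\<pi> dvd trace Y"
    using i uniformizer_nonzero by (intro trace_cong_of_det) (simp_all add: Y)
  then have "Y \<in> level i"
    using adjoint_module.trace_zero_mem[OF adjoint_module_level[OF i] X] by blast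
  then obtain k where k: "k \<in> H" "mat_cong \<pi> (i + 1) k (g ** B)"
    by (auto simp: level_def Y)
  have "mat_cong \<pi> (i + 1) (h ** k) (h ** (g ** B))" using k(2) by (rule mat_cong_mult_left)
  then have "mat_cong \<pi> (Suc i) (h ** k) B" by (simp add: matrix_mul_assoc g)
  then show "\<exists>h\<in>H. mat_cong \<pi> (Suc i) h B" using mult_mem h(1) k(1) by blast
qed

text \<open>Multiplying by the inverse \<open>q\<close> of \<open>h' ** h\<close> turns the
  difference into a group commutator. The factor \<open>q\<close> stays, since
  \<open>h' ** h\<close> need not reduce to the identity.\<close>

lemma commutator_level:
  assumes h: "h \<in> H" "h' \<in> H"
    and C: "mat_cong \<pi> (i + 1) (h ** h' - h' ** h) (mat_scale (\<pi> ^ i) C)"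
  obtains q where "q ** (h' ** h) = mat 1" "C ** q \<in> level i"
proof -
  obtain q where q: "q \<in> H" "(h' ** h) ** q = mat 1" "q ** (h' ** h) = mat 1"
    using inverse_obtain[OF mult_mem[OF h(2,1)]] .
  have "mat_cong \<pi> (i + 1) ((h' ** h + (h ** h' - h' ** h)) ** q) ((h' ** h + mat_scale (\<pi> ^ i) C) ** q)"
    by (intro mat_cong_mult_right mat_cong_add mat_cong_refl C)
  also have "(h' ** h + mat_scale (\<pi> ^ i) C) ** q = mat 1 + mat_scale (\<pi> ^ i) (C ** q)"
    by (simp add: matrix_add_rdistrib q mat_scale_mult_left)
  finally have "C ** q \<in> level i"
    unfolding level_def using mult_mem h q(1) by auto
  then show ?thesis using that q by blast
qed

text \<open>When both matrices reduce to the identity, neither the lifting errors nor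
  \<open>q\<close> affect the leading term, so the commutator may be computed with \<open>A\<close>
  and \<open>B\<close> themselves.\<close>

lemma congruent_commutator_level:
  assumes i: "i \<ge> 1" and surj: "surj_mod i"
    and det: "det A = 1" "det B = 1"
    and A: "mat_cong \<pi> 1 A (mat 1)" and B: "mat_cong \<pi> 1 B (mat 1)"
    and C: "A ** B - B ** A = mat_scale (\<pi> ^ i) C"
  shows "C \<in> level i"
proof -
  obtain h h' where h: "h \<in> H" "mat_cong \<pi> i h A" and h': "h' \<in> H" "mat_cong \<pi> i h' B"
    using surj det unfolding surj_mod_def by metis
  obtain Y where Y: "h = A + mat_scale (\<pi> ^ i) Y" using h(2) by (rule mat_cong_obtain)
  have 1: "mat_cong \<pi> 1 h (mat 1)" "mat_cong \<pi> 1 h' (mat 1)"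
    using mat_cong_mono[OF h(2) i] mat_cong_mono[OF h'(2) i] A B mat_cong_trans by blast+
  have "mat_cong \<pi> (i + 1) (h ** h' - h' ** h) (A ** B - B ** A + mat_scale (\<pi> ^ i) (Y ** B - B ** Y))"
    unfolding Y by (rule commutator_cong[OF i A h'(2)])
  also have "A ** B - B ** A + mat_scale (\<pi> ^ i) (Y ** B - B ** Y)
      = mat_scale (\<pi> ^ i) (C + (Y ** B - B ** Y))"
    by (simp add: C mat_scale_add)
  finally obtain q where q: "q ** (h' ** h) = mat 1" "(C + (Y ** B - B ** Y)) ** q \<in> level i"
    by (rule commutator_level[OF h(1) h'(1)])
  have "mat_cong \<pi> 1 (q ** (h' ** h)) (q ** (mat 1 ** mat 1))"
    by (intro mat_cong_mult_left mat_cong_mult 1)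
  then have "mat_cong \<pi> 1 q (mat 1)" by (simp add: q mat_cong_sym)
  then have "mat_cong \<pi> 1 ((C + (Y ** B - B ** Y)) ** q) ((C + (Y ** mat 1 - mat 1 ** Y)) ** mat 1)"
    by (intro mat_cong_mult mat_cong_add mat_cong_diff mat_cong_refl B)
  then show ?thesis
    using adjoint_module.cong_mem[OF adjoint_module_level[OF i] q(2)] by simp
qed

section \<open>Non-scalar elements in the layers beyond the first\<close>

lemma nonscalar_level_generic:
  fixes r s :: 'n
  assumes i: "i \<ge> 2" and surj: "surj_mod i" and rs: "r \<noteq> s"
    and gen: "\<not> \<pi> dvd 2 \<or> (\<exists>k. k \<noteq> r \<and> k \<noteq> s)"
  obtains X where "X \<in> level i" "\<And>c. \<not> mat_cong \<pi> 1 X (mat c)"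
proof -
  let ?A = "transvection s r \<pi>" and ?B = "transvection r s (\<pi> ^ (i - 1))"
  let ?C = "mat_unit s s 1 - mat_unit r r 1 :: 'a^'n^'n"
  have dvd: "\<pi> dvd \<pi> ^ (i - 1)" using i by simp
  have pow: "\<pi> * \<pi> ^ (i - Suc 0) = \<pi> ^ i" using i by (cases i) auto
  have "?C \<in> level i"
  proof (rule congruent_commutator_level[OF _ surj])
    show "?A ** ?B - ?B ** ?A = mat_scale (\<pi> ^ i) ?C"
      using rs by (auto simp: vec_eq_iff matrix_add_ldistrib matrix_add_rdistrib mat_unit_mult_nth
          pow mult.commute[of _ \<pi>])
  qed (use i rs dvd in \<open>auto simp: mat_cong_def intro: det_transvection\<close>)
  moreover have "\<not> mat_cong \<pi> 1 ?C (mat c)" for c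
  proof
    assume "mat_cong \<pi> 1 ?C (mat c)"
    then have *: "\<pi> dvd ?C $ k $ k - c" for k using mat_congD[of \<pi> 1 ?C "mat c" k k] by (simp add: mat_def)
    \<comment> \<open>The scalar would be both 1 and -1 modulo \<open>\<pi>\<close>, and also 0 if
      there is a third index; each alternative in \<open>gen\<close> excludes this.\<close>
    have s: "\<pi> dvd 1 - c" and r: "\<pi> dvd - 1 - c" using *[of s] *[of r] rs by auto
    from gen show False
    proof
      assume "\<not> \<pi> dvd 2"
      then show False using dvd_diff[OF s r] by simp
    next
      assume "\<exists>k. k \<noteq> r \<and> k \<noteq> s"
      then obtain k where "k \<noteq> r" "k \<noteq> s" by blast
      then have "\<pi> dvd c" using *[of k] by simp
      then show False using dvd_add[OF s] not_dvd_one by fastforce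
    qed
  qed
  ultimately show ?thesis using that by blast
qed

lemma nonscalar_level_char_2:
  fixes r s :: 'n
  assumes i: "i \<ge> 2" and surj: "surj_mod i" and rs: "r \<noteq> s"
    and two: "\<And>k. k = r \<or> k = s" and char: "(2::'a) = 0"
  obtains X where "X \<in> level i" "\<And>c. \<not> mat_cong \<pi> 1 X (mat c)"
proof -
  have "\<not> \<pi> dvd 1 + \<pi>" using not_dvd_one by (simp add: dvd_add_left_iff)
  then obtain v where v: "(1 + \<pi>) * v = 1" by (rule unit_obtain)
  then have v': "v * (1 + \<pi>) = 1" by (simp add: mult.commute)
  have v1: "v - 1 = - \<pi> * v" using v by (simp add: algebra_simps)
  have nv: "\<not> \<pi> dvd v" using v' by (rule not_dvd_unit)
  \<comment> \<open>The left side is \<open>v * ((1 + \<pi>)^2 - 1)\<close>, whose cross term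
    \<open>2 * \<pi> * v\<close> vanishes.\<close>
  have uv: "1 + \<pi> - v = \<pi>\<^sup>2 * v"
  proof -
    have "1 + \<pi> - v = (1 + \<pi>) * ((1 + \<pi>) * v) - v" by (simp add: v)
    also have "\<dots> = \<pi>\<^sup>2 * v + 2 * (\<pi> * v)" by (simp add: algebra_simps power2_eq_square)
    finally show ?thesis by (simp add: char)
  qed
  let ?A = "torus r s (1 + \<pi>) v" and ?B = "\<lambda>x. transvection r s (x * \<pi> ^ (i - 2))"
  have pow: "\<pi> ^ i = \<pi> ^ (i - 2) * \<pi>\<^sup>2" using i by (metis le_add_diff_inverse2 power_add)
  have A: "mat_cong \<pi> 1 ?A (mat 1)"
    by (auto simp: mat_cong_def torus_def mat_def v1)
  have detA: "det ?A = 1" and detB: "det (?B x) = 1" for x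
    using rs v by (auto intro: det_torus det_transvection)
  have AB: "?A ** ?B x - ?B x ** ?A = mat_scale (\<pi> ^ i) (mat_unit r s (x * v))" for x
  proof -
    have "?A ** ?B x - ?B x ** ?A = mat_unit r s (x * \<pi> ^ (i - 2) * (1 + \<pi> - v))"
      using rs by (auto simp: vec_eq_iff matrix_add_ldistrib matrix_add_rdistrib torus_def
          diag_mat_mult_nth mult_diag_mat_nth mat_unit_mult_nth algebra_simps)
    then show ?thesis by (simp add: uv pow vec_eq_iff mult_ac)
  qed
  show ?thesis
  proof (cases "i = 2")
    case False
    \<comment> \<open>For \<open>i > 2\<close> the power \<open>\<pi> ^ (i - 2)\<close> is divisible
      by \<open>\<pi>\<close>, so \<open>?B 1\<close> reduces to the identity.\<close>
    have "mat_unit r s (1 * v) \<in> level i"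
      by (rule congruent_commutator_level[OF _ surj detA detB A _ AB])
        (use i False in \<open>auto simp: mat_cong_def\<close>)
    moreover have "\<not> mat_cong \<pi> 1 (mat_unit r s (1 * v)) (mat c)" for c
      using nv by (intro not_scalar_of_entry[OF rs]) simp
    ultimately show ?thesis using that by blast
  next
    case i2: True
    obtain h where h: "h \<in> H" "mat_cong \<pi> i h ?A" using surj detA by (auto simp: surj_mod_def)
    obtain Y where Y: "h = ?A + mat_scale (\<pi> ^ i) Y" using h(2) by (rule mat_cong_obtain)
    \<comment> \<open>As B is not congruent to 1 here, the unknown Y enters the commutator. Its (r,s) entry is
      x (1 + x Y_sr) up to the trace of Y, which vanishes; x is chosen after Y.\<close>
    have trY: "\<pi> dvd Y $ r $ r - Y $ s $ s"
    proof -
      \<comment> \<open>Dividing \<open>h\<close> by its torus part makes the determinant condition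
        a trace condition on \<open>?A' ** Y\<close>.\<close>
      let ?A' = "torus r s v (1 + \<pi>) :: 'a^'n^'n"
      have "?A' ** h = mat 1 + mat_scale (\<pi> ^ i) (?A' ** Y)"
        using torus_inverse[OF rs v'] by (simp add: Y matrix_add_ldistrib mat_scale_mult_right)
      moreover have "det (?A' ** h) = 1" using det_torus[OF rs v'] det_mem[OF h(1)] by (simp add: det_mul)
      ultimately have "\<pi> dvd trace (?A' ** Y)"
        using i uniformizer_nonzero by (intro trace_cong_of_det) auto
      also have "trace (?A' ** Y) = v * Y $ r $ r + (1 + \<pi>) * Y $ s $ s"
      proof -
        have U: "UNIV = {r, s}" using two by auto
        show ?thesis unfolding trace_def U using rs by (simp add: torus_def diag_mat_mult_nth)
      qed
      finally have "\<pi> dvd v * Y $ r $ r + (1 + \<pi>) * Y $ s $ s" .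
      \<comment> \<open>The multiple of \<open>\<pi>\<close> turns both coefficients into 1, the
        first as \<open>v * (1 + \<pi>)\<close>; the sign of the second can be flipped because 2 is
        zero.\<close>
      then have "\<pi> dvd v * Y $ r $ r + (1 + \<pi>) * Y $ s $ s - \<pi> * (Y $ s $ s - v * Y $ r $ r)"
        by (rule dvd_diff) simp
      also have "\<dots> = v * (1 + \<pi>) * Y $ r $ r - Y $ s $ s + 2 * Y $ s $ s"
        by (simp add: algebra_simps)
      finally show ?thesis by (simp add: v' char)
    qed
    \<comment> \<open>\<open>x = 1\<close> serves unless \<open>Y $ s $ r\<close> is -1 modulo
      \<open>\<pi>\<close>; then the second quantity is \<open>1 - x\<close>, and any residue other
      than 0 and 1 serves.\<close>
    obtain x where x: "\<not> \<pi> dvd x" "\<not> \<pi> dvd 1 + x * Y $ s $ r"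
    proof (cases "\<pi> dvd 1 + Y $ s $ r")
      case True
      obtain x where x: "\<not> \<pi> dvd x - f" if "f \<in> {0, 1}" for f
        by (rule avoid_residues[of "{0, 1}"]) (auto simp: card_insert_if)
      have "\<not> \<pi> dvd 1 + x * Y $ s $ r"
      proof
        assume "\<pi> dvd 1 + x * Y $ s $ r"
        then have "\<pi> dvd x * (1 + Y $ s $ r) - (1 + x * Y $ s $ r)"
          by (rule dvd_diff[rotated]) (use True in simp)
        then show False using x[of 1] by (simp add: algebra_simps)
      qed
      then show ?thesis using that x[of 0] by simp
    next
      case False
      then show ?thesis using that[of 1] not_dvd_one by simp
    qed
    let ?B = "transvection r s x" and ?B' = "transvection r s (-x)"
    obtain h' where h': "h' \<in> H" "mat_cong \<pi> i h' ?B"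
      using surj det_transvection[OF rs] by (auto simp: surj_mod_def)
    let ?C = "mat_unit r s (x * v) + (Y ** ?B - ?B ** Y)"
    have "mat_cong \<pi> (i + 1) (h ** h' - h' ** h) (?A ** ?B - ?B ** ?A + mat_scale (\<pi> ^ i) (Y ** ?B - ?B ** Y))"
      unfolding Y using i by (intro commutator_cong A h'(2)) simp
    also have "?A ** ?B - ?B ** ?A + mat_scale (\<pi> ^ i) (Y ** ?B - ?B ** Y) = mat_scale (\<pi> ^ i) ?C"
      using AB[of x] by (simp add: i2 mat_scale_add)
    finally obtain q where q: "q ** (h' ** h) = mat 1" "?C ** q \<in> level i"
      by (rule commutator_level[OF h(1) h'(1)])
    \<comment> \<open>Modulo \<open>\<pi>\<close> the product \<open>h' ** h\<close> is
      \<open>?B\<close>, so its inverse \<open>q\<close> may be replaced by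
      \<open>?B'\<close>.\<close>
    have "mat_cong \<pi> 1 h (mat 1)" "mat_cong \<pi> 1 h' ?B"
      using mat_cong_mono[OF h(2), of 1] mat_cong_mono[OF h'(2), of 1] A i mat_cong_trans by auto
    then have "mat_cong \<pi> 1 (q ** (h' ** h) ** ?B') (q ** (?B ** mat 1) ** ?B')"
      by (intro mat_cong_mult_right mat_cong_mult_left mat_cong_mult)
    moreover have "q ** (?B ** mat 1) ** ?B' = q"
      using transvection_inverse[OF rs, of x] by (simp flip: matrix_mul_assoc)
    ultimately have "mat_cong \<pi> 1 q ?B'" using q(1) by (simp add: mat_cong_sym)
    then have "mat_cong \<pi> 1 (?C ** q) (?C ** ?B')" by (rule mat_cong_mult_left)
    then have mem: "?C ** ?B' \<in> level i"
      using i by (intro adjoint_module.cong_mem[OF adjoint_module_level q(2)]) auto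
    have entry: "(?C ** ?B') $ r $ s = x * v + x * (Y $ r $ r - Y $ s $ s) + x * x * Y $ s $ r"
      using rs by (simp add: matrix_add_ldistrib matrix_add_rdistrib mat_unit_mult_nth
          mult_mat_unit_nth algebra_simps)
    have "\<not> \<pi> dvd (?C ** ?B') $ r $ s"
    proof
      assume "\<pi> dvd (?C ** ?B') $ r $ s"
      \<comment> \<open>The added terms are multiples of \<open>\<pi>\<close>: they cancel the
        diagonal difference and complete \<open>v\<close> to \<open>(1 + \<pi>) * v\<close>, which
        is 1.\<close>
      then have "\<pi> dvd (?C ** ?B') $ r $ s + (\<pi> * (v * x) - x * (Y $ r $ r - Y $ s $ s))"
        using trY by (intro dvd_add[OF _ dvd_diff]) auto
      also have "\<dots> = x * ((1 + \<pi>) * v + x * Y $ s $ r)"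
        by (simp only: entry) (simp add: algebra_simps)
      finally show False using x by (simp add: v dvd_mult_iff)
    qed
    then show ?thesis using that[OF mem] not_scalar_of_entry[OF rs] by blast
  qed
qed

end

section \<open>Induction over the layers and passage to the limit\<close>

theorem mainTheorem13:
  fixes \<pi> :: "'a::idom"
    and H :: "('a^'n^'n) set"
  assumes "dvr_uniformizer \<pi>"
    and "padic_complete \<pi>"
    and "equal_char \<pi>"
    and "finite (residue_classes \<pi>)"
    and "card (residue_classes \<pi>) > 9"
    and "CARD('n) \<ge> 2"
    and "is_subgroup_SL H"
    and "padic_closed \<pi> H"
    and "reduction_is_SL \<pi> H"
    and "level1_nonscalar \<pi> H"
  shows "H = SL"
proof -
  interpret sl_subgroup \<pi> H by unfold_locales (fact assms)+
  obtain r s :: 'n where rs: "r \<noteq> s"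
    using assms(6) card_le_Suc0_iff_eq[of "UNIV :: 'n set"] by fastforce
  have nonscalar: "\<exists>X\<in>level i. \<forall>c. \<not> mat_cong \<pi> 1 X (mat c)" if "i \<ge> 2" "surj_mod i" for i
  proof (cases "\<not> \<pi> dvd 2 \<or> (\<exists>k. k \<noteq> r \<and> k \<noteq> s)")
    case True
    show ?thesis by (rule nonscalar_level_generic[OF that rs True]) blast
  next
    case False
    then have two: "k = r \<or> k = s" for k by blast
    \<comment> \<open>Equal characteristic upgrades divisibility of 2 by \<open>\<pi>\<close> to
      vanishing of 2 in the ring.\<close>
    have char: "(2::'a) = 0" using False assms(3) unfolding equal_char_def by (metis of_nat_numeral)
    show ?thesis by (rule nonscalar_level_char_2[OF that rs two char]) blast
  qed
  have nonscalar_1: "\<exists>X\<in>level 1. \<forall>c. \<not> mat_cong \<pi> 1 X (mat c)"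
  proof -
    obtain h where h: "h \<in> H" "mat_cong \<pi> 1 h (mat 1)" "\<And>c. \<not> mat_cong \<pi> 2 (h - mat 1) (mat c)"
      using assms(10) by (auto simp: level1_nonscalar_def)
    obtain X where X: "h = mat 1 + mat_scale (\<pi> ^ 1) X" using h(2) by (rule mat_cong_obtain)
    have "X \<in> level 1" using h(1) X mat_cong_refl unfolding level_def by blast
    moreover have "\<not> mat_cong \<pi> 1 X (mat c)" for c
    proof
      assume "mat_cong \<pi> 1 X (mat c)"
      then have "mat_cong \<pi> (1 + 1) (mat_scale (\<pi> ^ 1) X) (mat_scale (\<pi> ^ 1) (mat c))"
        by (rule mat_cong_scale)
      moreover have "mat_scale (\<pi> ^ 1) (mat c) = (mat (\<pi> * c) :: 'a^'n^'n)"
        by (auto simp: vec_eq_iff mat_def)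
      ultimately have "mat_cong \<pi> 2 (h - mat 1) (mat (\<pi> * c))" by (simp add: X numeral_2_eq_2)
      then show False using h(3) by blast
    qed
    ultimately show ?thesis by blast
  qed
  \<comment> \<open>The induction starts modulo \<open>\<pi>\<close> with the reduction hypothesis.
    The passage from exponent 1 to 2 uses the given non-scalar element, all later ones the
    constructed elements.\<close>
  have surj: "surj_mod (Suc i)" for i
  proof (induction i)
    case 0
    then show ?case using surj_mod_1 by simp
  next
    case (Suc i)
    have "\<exists>X\<in>level (Suc i). \<forall>c. \<not> mat_cong \<pi> 1 X (mat c)"
      using nonscalar[OF _ Suc] nonscalar_1 by (cases i) auto
    then show ?case using surj_mod_Suc[OF _ Suc] by auto
  qed
  have "B \<in> H" if "det B = 1" for B
  proof -
    \<comment> \<open>Approximations of every order put \<open>B\<close> in the closure of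
      \<open>H\<close>; weakening from \<open>Suc i\<close> to \<open>i\<close> also covers order
      0.\<close>
    have "\<exists>h\<in>H. mat_cong \<pi> i h B" for i
      using surj[of i] that mat_cong_mono[of \<pi> "Suc i" _ B i] unfolding surj_mod_def by fastforce
    then show ?thesis using assms(8) by (simp add: padic_closed_def)
  qed
  then show ?thesis using det_mem by (auto simp: SL_def)
qed

end
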